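(* Let $\Delta=\triangle ABC$ and $\Delta'=\triangle A'B'C'$ be two triangles. Let $\Pi_A$ be the open half plane containing $A$ bounded by the line $\overline{BC}$, and let $D\in\Pi_A$ and $\overline{D}\notin\Pi_A$ be the two points such that $\triangle DBC$ and $\triangle\overline{D}BC$ are regular triangles. Let $\widehat A'$ be a point in $\Pi_A$ such that $\triangle\widehat A'BC$ is similar to $\triangle A'B'C'$. Then the following conditions are equivalent: (1) $\Delta$ is equisectionally equivalent to $\Delta'$. (2) $\alpha(\Delta)=\alpha(\Delta')$; in other words, $\widehat A'$ is on the circle of Apollonius with foci $D$ and $\overline{D}$ that passes through $A$, i.e. on $C_A=\{X : |XD|/|X\overline{D}|=\alpha(\Delta)\}$ (which is the single point $\{A\}$ when $\Delta$ is regular). (3) $\beta(\Delta)=\beta(\Delta')$. (4) Let $A_2$ and $A_3$ be the points in $\Pi_A$ such that $\triangle BCA_2$ and $\triangle CA_3B$ are similar to $\triangle ABC$ with vertices corresponding in the written sequential order (i.e. $B\leftrightarrow A$, $C\leftrightarrow B$, $A_2\leftrightarrow C$ in the first case, and $C\leftrightarrow A$, $A_3\leftrightarrow B$, $B\leftrightarrow C$ in the second). Then $\widehat A'$ is on the circle that passes through $A$, $A_2$ and $A_3$ (when $\Delta$ is a regular triangle, this circle is understood to consist of the single point $A$).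
   Context: Triangles are nondegenerate triangles in the Euclidean plane $\cong\mathbb{C}$. Two triangles are called similar if some orientation-preserving similarity of the plane (translations, rotations and scalings by positive factors) carries one onto the other; unless a correspondence of vertices is specified, the labels of vertices need not be matched. Equisection operators: for $q\in\mathbb{R}$ and a triangle $\triangle PQR$ with vertices listed anticlockwise, $T_q(\triangle PQR)=\triangle P'Q'R'$ where $P'=qQ+(1-q)R$, $Q'=qR+(1-q)P$, $R'=qP+(1-q)Q$. (A cyclic relabelling of vertices does not change the resulting triangle.) Equisectional equivalence, denoted $\sim$, is the equivalence relation on the set of triangles generated by similarity and $\{T_q\}_{q\in\mathbb{R}}$ (i.e. by the relations $\Delta\sim\Delta'$ if similar, and $\Delta\sim T_q(\Delta)$ for all $q\in\mathbb{R}$). For a triangle $\Delta=\triangle ABC$, with $D,\overline{D}$ defined from $\Delta$ as the apexes of the two regular triangles with base $BC$, $D$ being on the same side of the line $BC$ as $A$, set $\alpha(\Delta)=\dfrac{|AD|}{|A\overline{D}|}$ and $\beta(\Delta)=\dfrac{|\triangle ABC|}{|A\overline{D}|^2}$, where $|\triangle ABC|$ is the area. One has $0\le\alpha(\Delta)<1$, and both numbers are independent of which edge of the triangle is chosen as the base $BC$; $\alpha(\Delta')$ and $\beta(\Delta')$ are defined in the same way from $\Delta'$. A circle of Apollonius with foci $D$ and $\overline{D}$ is a locus of points $X$ with $|XD|/|X\overline{D}|$ a given constant. *)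

theory Defs
  imports "HOL-Analysis.Analysis"
begin

(* A triangle is given by its unordered set of vertices. *)
definition is_triangle :: "complex set \<Rightarrow> bool" where
  "is_triangle S \<longleftrightarrow> (\<exists>P Q R. S = {P, Q, R} \<and> \<not> collinear {P, Q, R})"

(* The orientation-preserving similarities of the complex plane are exactly the
   maps z |-> a z + b with a nonzero. *)
definition direct_similarity :: "(complex \<Rightarrow> complex) \<Rightarrow> bool" where
  "direct_similarity f \<longleftrightarrow> (\<exists>a b. a \<noteq> 0 \<and> f = (\<lambda>z. a * z + b))"

definition similar_triangles :: "complex set \<Rightarrow> complex set \<Rightarrow> bool" where
  "similar_triangles S S' \<longleftrightarrow> (\<exists>f. direct_similarity f \<and> f ` S = S')"

(* similar_in_order A B C A' B' C': the correspondence is A to A', B to B', C to C'. *)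
definition similar_in_order ::
  "complex \<Rightarrow> complex \<Rightarrow> complex \<Rightarrow> complex \<Rightarrow> complex \<Rightarrow> complex \<Rightarrow> bool" where
  "similar_in_order A B C A' B' C' \<longleftrightarrow>
     (\<exists>f. direct_similarity f \<and> f A = A' \<and> f B = B' \<and> f C = C')"

(* The imaginary part is twice the signed area of the triangle P Q R. *)
definition anticlockwise :: "complex \<Rightarrow> complex \<Rightarrow> complex \<Rightarrow> bool" where
  "anticlockwise P Q R \<longleftrightarrow> Im (cnj (Q - P) * (R - P)) > 0"

definition equisection :: "real \<Rightarrow> complex \<Rightarrow> complex \<Rightarrow> complex \<Rightarrow> complex set" where
  "equisection q P Q R =
     {of_real q * Q + of_real (1 - q) * R,
      of_real q * R + of_real (1 - q) * P,
      of_real q * P + of_real (1 - q) * Q}"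

(* Hence equisection induces an operator on unlabelled triangles. *)
lemma equisection_cyclic: "equisection q Q R P = equisection q P Q R"
  by (auto simp: equisection_def)

definition equisection_step :: "complex set \<Rightarrow> complex set \<Rightarrow> bool" where
  "equisection_step S S' \<longleftrightarrow>
     (\<exists>q P Q R. anticlockwise P Q R \<and> S = {P, Q, R} \<and> S' = equisection q P Q R)"

definition equisectionally_equivalent :: "complex set \<Rightarrow> complex set \<Rightarrow> bool" where
  "equisectionally_equivalent =
     equivclp (\<lambda>S S'. is_triangle S \<and> is_triangle S' \<and>
                      (similar_triangles S S' \<or> equisection_step S S'))"

(* The open half plane containing A bounded by the line BC, for A not on that line. *)
definition open_half_plane :: "complex \<Rightarrow> complex \<Rightarrow> complex \<Rightarrow> complex set" where
  "open_half_plane A B C = {X. closed_segment A X \<inter> affine hull {B, C} = {}}"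

definition regular_triangle :: "complex \<Rightarrow> complex \<Rightarrow> complex \<Rightarrow> bool" where
  "regular_triangle P Q R \<longleftrightarrow>
     \<not> collinear {P, Q, R} \<and> dist P Q = dist Q R \<and> dist Q R = dist R P"

definition apex_near :: "complex \<Rightarrow> complex \<Rightarrow> complex \<Rightarrow> complex" where
  "apex_near A B C = (THE D. D \<in> open_half_plane A B C \<and> regular_triangle D B C)"

definition apex_far :: "complex \<Rightarrow> complex \<Rightarrow> complex \<Rightarrow> complex" where
  "apex_far A B C = (THE D. D \<notin> open_half_plane A B C \<and> regular_triangle D B C)"

definition tri_alpha :: "complex \<Rightarrow> complex \<Rightarrow> complex \<Rightarrow> real" where
  "tri_alpha A B C = dist A (apex_near A B C) / dist A (apex_far A B C)"

definition tri_beta :: "complex \<Rightarrow> complex \<Rightarrow> complex \<Rightarrow> real" where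
  "tri_beta A B C =
     measure lebesgue (convex hull {A, B, C}) / (dist A (apex_far A B C))\<^sup>2"

(* X = E is excluded explicitly: since x / 0 = 0, it would otherwise satisfy the
   equation for k = 0. *)
definition apollonius_circle :: "complex \<Rightarrow> complex \<Rightarrow> real \<Rightarrow> complex set" where
  "apollonius_circle D E k = {X. X \<noteq> E \<and> dist X D / dist X E = k}"

definition circle_through :: "complex \<Rightarrow> complex \<Rightarrow> complex \<Rightarrow> complex set" where
  "circle_through P Q R =
     (THE S. (\<exists>c r. r > 0 \<and> S = sphere c r) \<and> P \<in> S \<and> Q \<in> S \<and> R \<in> S)"

end

theory Submission
  imports Defs
begin

text \<open>
  Let w be the primitive cube root of unity with positive imaginary part. Up to direct similarity a
  labelled anticlockwise triangle PQR is determined by the quotient of its Lagrange resolvents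
  s = P + wQ + w^2 R and t = P + w^2 Q + wR, and a cyclic relabelling multiplies this quotient by a
  cube root of unity. The operator for q multiplies s by c and t by the conjugate of c, where
  c = q w^2 + (1 - q) w runs over the line of real part -1/2; hence it multiplies s/t by an arbitrary
  complex unit except -1. So the equisectional class of a triangle is exactly |s/t|.
  As |s| and |t| are the distances from P to the near and the far apex over QR, this invariant is
  alpha; and since |t|^2 - |s|^2 is proportional to the area, beta is an affine function of alpha^2.
  The points A, A2 and A3 have the same alpha, hence lie on the circle of Apollonius, and they are
  distinct unless the triangle is regular.
\<close>

subsection \<open>Orientation and Lagrange resolvents\<close>

text \<open>Kept as a real number so that orientation, collinearity and the side of a line all
  become sign conditions on one expression.\<close>

definition orient :: "complex \<Rightarrow> complex \<Rightarrow> complex \<Rightarrow> real" where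
  "orient P Q R = Im (cnj (Q - P) * (R - P))"

definition omega :: complex where
  "omega = Complex (- 1 / 2) (sqrt 3 / 2)"

text \<open>A Fourier coefficient of the triangle at a nontrivial character of the cyclic group,
  \<open>cnj omega\<close> being the square of \<open>omega\<close>. The other nontrivial
  coefficient is \<open>resolvent P R Q\<close>.\<close>

definition resolvent :: "complex \<Rightarrow> complex \<Rightarrow> complex \<Rightarrow> complex" where
  "resolvent P Q R = P + omega * Q + cnj omega * R"

lemma Re_omega [simp]: "Re omega = - 1 / 2" and Im_omega [simp]: "Im omega = sqrt 3 / 2"
  by (simp_all add: omega_def)

lemma cnj_omega: "cnj omega = - 1 - omega"
  by (simp add: complex_eq_iff)

lemma omega_square: "omega * omega = - 1 - omega"
  by (simp add: complex_eq_iff)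

lemma omega_square_left: "omega * (omega * z) = - z - omega * z"
  by (metis (no_types) omega_square mult.assoc mult_minus1 left_diff_distrib)

lemma norm_omega [simp]: "cmod omega = 1"
  by (simp add: cmod_def power2_eq_square)

lemma orient_swap: "orient P R Q = - orient P Q R"
  by (simp add: orient_def algebra_simps)

lemma orient_rotate: "orient P Q R = orient Q R P"
  by (simp add: orient_def algebra_simps)

lemma anticlockwise_iff: "anticlockwise P Q R \<longleftrightarrow> orient P Q R > 0"
  by (simp add: anticlockwise_def orient_def)

lemma orient_distinct: "orient P Q R \<noteq> 0 \<Longrightarrow> P \<noteq> Q \<and> Q \<noteq> R \<and> P \<noteq> R"
  by (auto simp: orient_def algebra_simps)

text \<open>For distinct \<open>P\<close> and \<open>Q\<close>, the imaginary part of
  \<open>(R - P) / (Q - P)\<close> is \<open>orient P Q R\<close> divided by the squared length of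
  \<open>Q - P\<close>.\<close>

lemma collinear_iff_orient: "collinear {P, Q, R} \<longleftrightarrow> orient P Q R = 0"
proof -
  have "collinear {P, Q, R} \<longleftrightarrow> collinear {Q, P, R}"
    by (simp add: insert_commute)
  also have "\<dots> \<longleftrightarrow> collinear {0, Q - P, R - P}"
    by (subst collinear_3) simp_all
  also have "\<dots> \<longleftrightarrow> (R - P) / (Q - P) \<in> \<real>"
    by (rule collinear_iff_Reals)
  also have "\<dots> \<longleftrightarrow> orient P Q R = 0"
  proof (cases "Q = P")
    case False
    then have "(Re (Q - P))\<^sup>2 + (Im (Q - P))\<^sup>2 \<noteq> 0"
      by (metis complex_neq_0 eq_iff_diff_eq_0 less_irrefl)
    then show ?thesis
      using False by (auto simp: complex_is_Real_iff orient_def Im_divide algebra_simps complex_eq_iff)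
  qed (simp add: orient_def)
  finally show ?thesis .
qed

text \<open>Expansion in coordinates. The sign of this identity compares the two moduli, and its
  value yields the area.\<close>

lemma norm_resolvent_diff:
  "2 * sqrt 3 * orient P Q R = (cmod (resolvent P R Q))\<^sup>2 - (cmod (resolvent P Q R))\<^sup>2"
  unfolding cmod_power2 resolvent_def orient_def
  by (simp add: power2_eq_square algebra_simps)

lemma resolvent_rotate: "resolvent P Q R = omega * resolvent Q R P"
  by (simp add: resolvent_def cnj_omega algebra_simps omega_square omega_square_left)

lemma norm_resolvent_rotate: "cmod (resolvent P Q R) = cmod (resolvent Q R P)"
  by (simp add: resolvent_rotate[of P Q R] norm_mult)

lemma resolvent_affine: "resolvent (a * P + b) (a * Q + b) (a * R + b) = a * resolvent P Q R"
  by (simp add: resolvent_def cnj_omega algebra_simps)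

text \<open>Fourier inversion: \<open>1 + omega + cnj omega = 0\<close> cancels \<open>Q\<close> and
  \<open>R\<close>.\<close>

lemma resolvent_inversion:
  "3 * P = (P + Q + R) + resolvent P Q R + resolvent P R Q"
  by (simp add: resolvent_def cnj_omega algebra_simps)

text \<open>Each resolvent vanishes for one of the two apexes over the base \<open>Q R\<close>. Both
  vanish when the three points coincide, whence the condition on \<open>Q\<close> and
  \<open>R\<close>.\<close>

lemma regular_iff_resolvent:
  "regular_triangle P Q R \<longleftrightarrow> Q \<noteq> R \<and> (resolvent P Q R = 0 \<or> resolvent P R Q = 0)"
proof
  assume L: "regular_triangle P Q R"
  then have d: "dist P Q = dist Q R" "dist Q R = dist R P" and "\<not> collinear {P, Q, R}"
    by (auto simp: regular_triangle_def)
  then have "Q \<noteq> R" by auto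
  \<comment> \<open>Moves the base to 0 and 1, so that the apex becomes an intersection of the unit
    circles about these points.\<close>
  define z where "z = (P - Q) / (R - Q)"
  have P: "P = Q + z * (R - Q)" using \<open>Q \<noteq> R\<close> by (simp add: z_def)
  have PQ: "P - Q = z * (R - Q)" "R - P = (1 - z) * (R - Q)"
    unfolding P by (simp_all add: algebra_simps)
  have "cmod z * cmod (R - Q) = cmod (R - Q)" "cmod (1 - z) * cmod (R - Q) = cmod (R - Q)"
    using d unfolding norm_mult[symmetric] PQ[symmetric] by (metis dist_norm norm_minus_commute)+
  then have "(cmod z)\<^sup>2 = 1" "(cmod (1 - z))\<^sup>2 = 1" using \<open>Q \<noteq> R\<close> by auto
  then have e: "(Re z)\<^sup>2 + (Im z)\<^sup>2 = 1" "(1 - Re z)\<^sup>2 + (Im z)\<^sup>2 = 1"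
    by (simp_all add: cmod_power2)
  then have "Re z = 1/2" by (simp add: power2_eq_square algebra_simps)
  with e have "(Im z)\<^sup>2 = (sqrt 3 / 2)\<^sup>2" by (simp add: power2_eq_square)
  then have "Im z = sqrt 3 / 2 \<or> Im z = - sqrt 3 / 2" by (simp add: power2_eq_iff)
  then have "z = - cnj omega \<or> z = - omega" using \<open>Re z = 1/2\<close> by (auto simp: complex_eq_iff)
  then show "Q \<noteq> R \<and> (resolvent P Q R = 0 \<or> resolvent P R Q = 0)"
    using \<open>Q \<noteq> R\<close> by (auto simp: P resolvent_def cnj_omega algebra_simps)
next
  assume R: "Q \<noteq> R \<and> (resolvent P Q R = 0 \<or> resolvent P R Q = 0)"
  show "regular_triangle P Q R"
  proof -
    from R consider "P = - omega * Q - cnj omega * R" | "P = - omega * R - cnj omega * Q"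
      by (auto simp: resolvent_def eq_neg_iff_add_eq_0 algebra_simps)
    \<comment> \<open>Treats both apexes at once, \<open>v\<close> being a primitive cube root of
      unity.\<close>
    then have "\<exists>v. (v = omega \<or> v = cnj omega) \<and> P = - v * Q - cnj v * R"
      by cases (metis, metis complex_cnj_cnj diff_minus_eq_add add_uminus_conv_diff add.commute mult_minus_left)
    then obtain v where v: "v = omega \<or> v = cnj omega" and P: "P = - v * Q - cnj v * R"
      by blast
    have n: "cmod v = 1" using v by auto
    have "v + cnj v = -1" using v by (auto simp: complex_eq_iff)
    then have v': "cnj v = -1 - v" by (simp add: eq_diff_eq add.commute)
    have "P - Q = cnj v * (Q - R)" "R - P = v * (Q - R)"
      unfolding P v' by (simp_all add: algebra_simps)
    then have d: "dist P Q = dist Q R" "dist R P = dist Q R"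
      using n by (simp_all add: dist_norm norm_mult)
    \<comment> \<open>With zero area the two resolvents have equal moduli, so both vanish; but their
      difference is \<open>(omega - cnj omega) * (Q - R)\<close>.\<close>
    have "orient P Q R \<noteq> 0"
    proof
      assume "orient P Q R = 0"
      then have "resolvent P Q R = 0" "resolvent P R Q = 0"
        using R norm_resolvent_diff[of P Q R] by auto
      then have "P + omega * Q + cnj omega * R = 0" "P + omega * R + cnj omega * Q = 0"
        by (simp_all add: resolvent_def)
      then have "(P + omega * Q + cnj omega * R) - (P + omega * R + cnj omega * Q) = 0" by simp
      then have "(omega - cnj omega) * (Q - R) = 0" by (simp add: algebra_simps)
      then show False using R by (auto simp: complex_eq_iff)
    qed
    then show ?thesis using d by (simp add: regular_triangle_def collinear_iff_orient)
  qed
qed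

subsection \<open>Half planes and apexes\<close>

lemma orient_eq_0_iff_hull:
  assumes "B \<noteq> C"
  shows "Z \<in> affine hull {B, C} \<longleftrightarrow> orient Z B C = 0"
  using collinear_3_affine_hull[OF assms, of Z]
  by (metis collinear_iff_orient insert_commute orient_rotate)

lemma orient_affine_left:
  "orient ((1 - u) *\<^sub>R A + u *\<^sub>R X) B C = (1 - u) * orient A B C + u * orient X B C"
  by (simp add: orient_def algebra_simps)

text \<open>\<open>orient\<close> is affine along the segment from \<open>A\<close> to
  \<open>X\<close>, so the segment misses the line exactly when the values at its ends have the same
  strict sign.\<close>

lemma open_half_plane_iff:
  assumes "orient A B C \<noteq> 0"
  shows "X \<in> open_half_plane A B C \<longleftrightarrow> orient A B C * orient X B C > 0"
proof -
  define a x where "a = orient A B C" and "x = orient X B C"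
  have "B \<noteq> C" using assms orient_distinct[of A B C] by auto
  have "X \<in> open_half_plane A B C \<longleftrightarrow> \<not> (\<exists>u. 0 \<le> u \<and> u \<le> 1 \<and> (1 - u) * a + u * x = 0)"
    unfolding open_half_plane_def closed_segment_def a_def x_def orient_affine_left[symmetric]
    using orient_eq_0_iff_hull[OF \<open>B \<noteq> C\<close>] by auto
  also have "\<dots> \<longleftrightarrow> a * x > 0"
  proof
    assume *: "\<not> (\<exists>u. 0 \<le> u \<and> u \<le> 1 \<and> (1 - u) * a + u * x = 0)"
    show "a * x > 0"
    proof (rule ccontr)
      assume "\<not> a * x > 0"
      with assms have "(a > 0 \<and> x \<le> 0) \<or> (a < 0 \<and> x \<ge> 0)"
        by (auto simp: a_def zero_less_mult_iff)
      \<comment> \<open>\<open>a / (a - x)\<close> is the zero of the interpolation.\<close>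
      then have "0 \<le> a / (a - x) \<and> a / (a - x) \<le> 1 \<and> (1 - a / (a - x)) * a + a / (a - x) * x = 0"
        by (auto simp: divide_simps)
      with * show False by blast
    qed
  next
    assume ax: "a * x > 0"
    show "\<not> (\<exists>u. 0 \<le> u \<and> u \<le> 1 \<and> (1 - u) * a + u * x = 0)"
    proof clarify
      fix u :: real assume u: "0 \<le> u" "u \<le> 1" "(1 - u) * a + u * x = 0"
      \<comment> \<open>Multiplication by \<open>a\<close> makes both terms nonnegative, and they
        cannot both vanish.\<close>
      then have "((1 - u) * a + u * x) * a = 0" by simp
      then have "(1 - u) * a\<^sup>2 + u * (a * x) = 0" by (simp add: algebra_simps power2_eq_square)
      moreover have "a\<^sup>2 > 0" using assms by (simp add: a_def)
      ultimately show False
        using u ax by (smt (verit) mult_nonneg_nonneg mult_pos_pos)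
    qed
  qed
  finally show ?thesis by (simp add: a_def x_def)
qed


lemma orient_affine: "orient (a * P + b) (a * Q + b) (a * R + b) = (cmod a)\<^sup>2 * orient P Q R"
  unfolding cmod_power2 by (simp add: orient_def power2_eq_square algebra_simps)

lemma norm_resolvent_less:
  assumes "orient P Q R > 0"
  shows "cmod (resolvent P Q R) < cmod (resolvent P R Q)"
proof (rule power2_less_imp_less)
  have "2 * sqrt 3 * orient P Q R > 0" using assms by simp
  then show "(cmod (resolvent P Q R))\<^sup>2 < (cmod (resolvent P R Q))\<^sup>2"
    using norm_resolvent_diff[of P Q R] by linarith
qed simp

text \<open>Positive orientation makes the first resolvent strictly smaller in modulus, so it is the
  one that vanishes.\<close>

lemma regular_pos_iff:
  assumes "B \<noteq> C"
  shows "regular_triangle D B C \<and> orient D B C > 0 \<longleftrightarrow> resolvent D B C = 0"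
proof
  assume L: "regular_triangle D B C \<and> orient D B C > 0"
  then show "resolvent D B C = 0"
    using regular_iff_resolvent[of D B C] norm_resolvent_less[of D B C] by auto
next
  assume R: "resolvent D B C = 0"
  then have reg: "regular_triangle D B C" using assms regular_iff_resolvent by blast
  then have "orient D B C \<noteq> 0" by (simp add: regular_triangle_def collinear_iff_orient)
  moreover have "2 * sqrt 3 * orient D B C \<ge> 0"
    using norm_resolvent_diff[of D B C] R by simp
  ultimately show "regular_triangle D B C \<and> orient D B C > 0"
    using reg by (simp add: zero_le_mult_iff)
qed

lemma regular_triangle_rotate: "regular_triangle P Q R \<longleftrightarrow> regular_triangle Q R P"
  by (auto simp: regular_triangle_def insert_commute)

lemma regular_triangle_swap: "regular_triangle D C B \<longleftrightarrow> regular_triangle D B C"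
  by (auto simp: regular_triangle_def insert_commute dist_commute)

lemma open_half_plane_swap: "open_half_plane A C B = open_half_plane A B C"
  by (simp add: open_half_plane_def insert_commute)

lemma near_apex_iff:
  assumes "orient A B C > 0"
  shows "D \<in> open_half_plane A B C \<and> regular_triangle D B C \<longleftrightarrow> D = - omega * B - cnj omega * C"
proof -
  have "B \<noteq> C" using assms orient_distinct[of A B C] by auto
  have "D \<in> open_half_plane A B C \<and> regular_triangle D B C \<longleftrightarrow> resolvent D B C = 0"
    using regular_pos_iff[OF \<open>B \<noteq> C\<close>] open_half_plane_iff[of A B C D] assms
    by (auto simp: zero_less_mult_iff)
  then show ?thesis by (auto simp: resolvent_def eq_diff_eq eq_neg_iff_add_eq_0 algebra_simps)
qed

text \<open>A regular triangle is nondegenerate, so its apex outside the half plane lies strictly on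
  the other side; exchanging \<open>B\<close> and \<open>C\<close> restores positive
  orientation.\<close>

lemma far_apex_iff:
  assumes "orient A B C > 0"
  shows "D \<notin> open_half_plane A B C \<and> regular_triangle D B C \<longleftrightarrow> D = - omega * C - cnj omega * B"
proof -
  have "C \<noteq> B" using assms orient_distinct[of A B C] by auto
  have "regular_triangle D B C \<Longrightarrow> orient D B C \<noteq> 0"
    by (simp add: regular_triangle_def collinear_iff_orient)
  then have "D \<notin> open_half_plane A B C \<and> regular_triangle D B C \<longleftrightarrow> resolvent D C B = 0"
    using regular_pos_iff[OF \<open>C \<noteq> B\<close>, of D] open_half_plane_iff[of A B C D] assms
    by (auto simp: zero_less_mult_iff mult_less_0_iff regular_triangle_swap orient_swap[of D B C])
  then show ?thesis by (auto simp: resolvent_def eq_diff_eq eq_neg_iff_add_eq_0 algebra_simps)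
qed

text \<open>The base enters symmetrically. Such swaps reduce negatively oriented labellings to
  positive ones, for which explicit formulas hold.\<close>

lemma apex_near_swap: "apex_near A C B = apex_near A B C"
  by (simp add: apex_near_def open_half_plane_swap regular_triangle_swap)

lemma apex_far_swap: "apex_far A C B = apex_far A B C"
  by (simp add: apex_far_def open_half_plane_swap regular_triangle_swap)

lemma apex_near_eq: "orient A B C > 0 \<Longrightarrow> apex_near A B C = - omega * B - cnj omega * C"
  by (simp add: apex_near_def near_apex_iff)

lemma apex_far_eq: "orient A B C > 0 \<Longrightarrow> apex_far A B C = - omega * C - cnj omega * B"
  by (simp add: apex_far_def far_apex_iff)

text \<open>Identifies an apex known by its properties with the definite description inside
  \<open>tri_alpha\<close>, in either orientation.\<close>

lemma apex_near_unique:
  assumes "orient A B C \<noteq> 0" "D \<in> open_half_plane A B C" "regular_triangle D B C"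
  shows "D = apex_near A B C"
proof (cases "orient A B C > 0")
  case True
  then show ?thesis using assms near_apex_iff apex_near_eq by metis
next
  case False
  then have "orient A C B > 0" using assms(1) by (simp add: orient_swap[of A B C])
  then show ?thesis
    using assms near_apex_iff apex_near_eq apex_near_swap open_half_plane_swap regular_triangle_swap
    by metis
qed

lemma apex_far_unique:
  assumes "orient A B C \<noteq> 0" "D \<notin> open_half_plane A B C" "regular_triangle D B C"
  shows "D = apex_far A B C"
proof (cases "orient A B C > 0")
  case True
  then show ?thesis using assms far_apex_iff apex_far_eq by metis
next
  case False
  then have "orient A C B > 0" using assms(1) by (simp add: orient_swap[of A B C])
  then show ?thesis
    using assms far_apex_iff apex_far_eq apex_far_swap open_half_plane_swap regular_triangle_swap
    by metis
qed

subsection \<open>Invariance of alpha\<close>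

lemma tri_alpha_swap: "tri_alpha A C B = tri_alpha A B C"
  by (simp add: tri_alpha_def apex_near_swap apex_far_swap)

lemma tri_beta_swap: "tri_beta A C B = tri_beta A B C"
  by (simp add: tri_beta_def apex_far_swap insert_commute)

lemma dist_apex_far: "orient A B C > 0 \<Longrightarrow> dist A (apex_far A B C) = cmod (resolvent A C B)"
  by (simp add: apex_far_eq dist_norm resolvent_def algebra_simps)

text \<open>By the explicit apexes, \<open>A - apex_near A B C\<close> is
  \<open>resolvent A B C\<close> and \<open>A - apex_far A B C\<close> is
  \<open>resolvent A C B\<close>.\<close>

lemma tri_alpha_pos:
  assumes "orient A B C > 0"
  shows "tri_alpha A B C = cmod (resolvent A B C) / cmod (resolvent A C B)"
  using assms by (simp add: tri_alpha_def dist_apex_far apex_near_eq)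
    (simp add: dist_norm resolvent_def algebra_simps)

lemma tri_alpha_bounds:
  assumes "orient A B C \<noteq> 0"
  shows "0 \<le> tri_alpha A B C" "tri_alpha A B C < 1"
proof -
  have *: "0 \<le> tri_alpha A B C \<and> tri_alpha A B C < 1" if "orient A B C > 0" for B C
    using norm_resolvent_less[OF that] tri_alpha_pos[OF that]
    by (simp add: divide_less_eq_1)
  have "0 \<le> tri_alpha A B C \<and> tri_alpha A B C < 1"
  proof (cases "orient A B C > 0")
    case False
    then have "orient A C B > 0" using assms by (simp add: orient_swap[of A B C])
    then show ?thesis using *[of C B] tri_alpha_swap by simp
  qed (rule *)
  then show "0 \<le> tri_alpha A B C" "tri_alpha A B C < 1" by auto
qed

text \<open>Rotating the labels multiplies each resolvent by a cube root of unity, which leaves its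
  modulus unchanged.\<close>

lemma tri_alpha_rotate:
  assumes "orient A B C \<noteq> 0"
  shows "tri_alpha B C A = tri_alpha A B C"
proof (cases "orient A B C > 0")
  case True
  then have "orient B C A > 0" using orient_rotate[of A B C] by simp
  then show ?thesis using True by (simp add: tri_alpha_pos norm_resolvent_rotate[of B C A]
        norm_resolvent_rotate[of A B C] norm_resolvent_rotate[of C B A] norm_resolvent_rotate[of B A C])
next
  case False
  then have "orient A C B > 0" using assms by (simp add: orient_swap[of A B C])
  moreover from this have "orient B A C > 0" using orient_rotate[of B A C] by simp
  ultimately have "tri_alpha B A C = tri_alpha A C B"
    by (simp add: tri_alpha_pos norm_resolvent_rotate[of A B C] norm_resolvent_rotate[of B C A]
        norm_resolvent_rotate[of C B A] norm_resolvent_rotate[of B A C])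
  then show ?thesis by (simp add: tri_alpha_swap)
qed

text \<open>Rotation and swap generate all six permutations, so alpha depends on the vertex set
  only.\<close>

lemma tri_alpha_relabel:
  assumes "orient A B C \<noteq> 0" "{P, Q, R} = {A, B, C}"
  shows "tri_alpha P Q R = tri_alpha A B C"
proof -
  have "A \<noteq> B" "B \<noteq> C" "A \<noteq> C" using assms(1) orient_distinct[of A B C] by auto
  then have "card {P, Q, R} = 3" using assms(2) by simp
  then have "P \<noteq> Q" "Q \<noteq> R" "P \<noteq> R" by (auto simp: card_insert_if split: if_splits)
  have in_ABC: "P \<in> {A, B, C}" "Q \<in> {A, B, C}" "R \<in> {A, B, C}"
    using assms(2) by blast+
  have "orient B C A \<noteq> 0" using assms(1) orient_rotate[of A B C] by simp
  then have "tri_alpha B C A = tri_alpha A B C" "tri_alpha C A B = tri_alpha A B C"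
    using tri_alpha_rotate[OF assms(1)] tri_alpha_rotate[of B C A] by auto
  note rot = this
  consider "P = A" "Q = B" "R = C" | "P = A" "Q = C" "R = B"
    | "P = B" "Q = A" "R = C" | "P = B" "Q = C" "R = A"
    | "P = C" "Q = A" "R = B" | "P = C" "Q = B" "R = A"
    using in_ABC \<open>P \<noteq> Q\<close> \<open>Q \<noteq> R\<close> \<open>P \<noteq> R\<close> by (elim insertE emptyE) simp_all
  then show ?thesis
    using rot tri_alpha_swap[of A C B] tri_alpha_swap[of B A C] tri_alpha_swap[of C B A]
    by cases simp_all
qed

lemma orient_relabel:
  assumes "orient A B C \<noteq> 0" "{P, Q, R} = {A, B, C}"
  shows "orient P Q R \<noteq> 0"
  using assms(1) unfolding collinear_iff_orient[symmetric] assms(2) .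

lemma tri_alpha_affine:
  assumes "orient P Q R \<noteq> 0" "a \<noteq> 0"
  shows "tri_alpha (a * P + b) (a * Q + b) (a * R + b) = tri_alpha P Q R"
proof -
  have *: "tri_alpha (a * P + b) (a * Q + b) (a * R + b) = tri_alpha P Q R"
    if "orient P Q R > 0" for Q R
    using that assms(2) by (simp add: tri_alpha_pos orient_affine resolvent_affine norm_mult)
  show ?thesis
  proof (cases "orient P Q R > 0")
    case False
    then have "orient P R Q > 0" using assms by (simp add: orient_swap[of P Q R])
    then show ?thesis using *[of R Q] by (simp add: tri_alpha_swap)
  qed (rule *)
qed

lemma is_triangleI: "orient P Q R \<noteq> 0 \<Longrightarrow> is_triangle {P, Q, R}"
  unfolding is_triangle_def collinear_iff_orient
  by (intro exI[of _ P] exI[of _ Q] exI[of _ R]) simp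

lemma is_triangleE:
  assumes "is_triangle S"
  obtains P Q R where "S = {P, Q, R}" "orient P Q R > 0"
proof -
  obtain P Q R where S: "S = {P, Q, R}" "orient P Q R \<noteq> 0"
    using assms by (auto simp: is_triangle_def collinear_iff_orient)
  show thesis
  proof (cases "orient P Q R > 0")
    case False
    then have "orient P R Q > 0" "S = {P, R, Q}"
      using S by (auto simp: orient_swap[of P Q R])
    then show thesis using that by blast
  qed (use S that in blast)
qed

lemma tri_alpha_similar:
  assumes "orient P Q R \<noteq> 0" "similar_triangles {P, Q, R} {X, Y, Z}"
  shows "tri_alpha X Y Z = tri_alpha P Q R" "orient X Y Z \<noteq> 0"
proof -
  obtain a b where a: "a \<noteq> 0" and "(\<lambda>z. a * z + b) ` {P, Q, R} = {X, Y, Z}"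
    using assms(2) by (auto simp: similar_triangles_def direct_similarity_def)
  then have eq: "{X, Y, Z} = {a * P + b, a * Q + b, a * R + b}" by simp
  have o: "orient (a * P + b) (a * Q + b) (a * R + b) \<noteq> 0"
    using assms(1) a by (simp add: orient_affine)
  show "orient X Y Z \<noteq> 0" using orient_relabel[OF o eq] .
  show "tri_alpha X Y Z = tri_alpha P Q R"
    using tri_alpha_relabel[OF o eq] tri_alpha_affine[OF assms(1) a] by simp
qed

section \<open>Action of the equisection operators on the resolvents\<close>

definition equisection_factor :: "real \<Rightarrow> complex" where
  "equisection_factor q = of_real q * cnj omega + of_real (1 - q) * omega"

text \<open>The real part is -1/2 for every \<open>q\<close>.\<close>

lemma equisection_factor_nonzero [simp]: "equisection_factor q \<noteq> 0"
  by (auto simp: equisection_factor_def complex_eq_iff algebra_simps)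

text \<open>The operator is circulant, hence diagonal on Fourier coefficients. Both moduli are
  scaled by the same positive number, so their strict order, and with it the orientation,
  persists.\<close>

lemma resolvent_equisection:
  fixes q :: real and P Q R :: complex
  defines "P' \<equiv> of_real q * Q + of_real (1 - q) * R" and "Q' \<equiv> of_real q * R + of_real (1 - q) * P"
    and "R' \<equiv> of_real q * P + of_real (1 - q) * Q"
  shows "resolvent P' Q' R' = equisection_factor q * resolvent P Q R"
    and "resolvent P' R' Q' = cnj (equisection_factor q) * resolvent P R Q"
    and "orient P Q R > 0 \<Longrightarrow> orient P' Q' R' > 0"
proof -
  show 1: "resolvent P' Q' R' = equisection_factor q * resolvent P Q R"
    by (simp add: P'_def Q'_def R'_def resolvent_def equisection_factor_def cnj_omega algebra_simps
        omega_square omega_square_left)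
  show 2: "resolvent P' R' Q' = cnj (equisection_factor q) * resolvent P R Q"
    by (simp add: P'_def Q'_def R'_def resolvent_def equisection_factor_def cnj_omega algebra_simps
        omega_square omega_square_left)
  assume o: "orient P Q R > 0"
  have "cmod (resolvent P' Q' R') < cmod (resolvent P' R' Q')"
    unfolding 1 2 norm_mult complex_mod_cnj using norm_resolvent_less[OF o] by simp
  then have "(cmod (resolvent P' Q' R'))\<^sup>2 < (cmod (resolvent P' R' Q'))\<^sup>2"
    by (intro power_strict_mono) auto
  then have "0 < 2 * sqrt 3 * orient P' Q' R'" using norm_resolvent_diff[of P' Q' R'] by linarith
  then show "orient P' Q' R' > 0" by (simp add: zero_less_mult_iff)
qed

lemma tri_alpha_equisection_step:
  assumes "equisection_step S S'" "S = {A, B, C}" "S' = {X, Y, Z}"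
  shows "tri_alpha A B C = tri_alpha X Y Z"
proof -
  obtain q P Q R where o: "orient P Q R > 0" and S: "S = {P, Q, R}" and S': "S' = equisection q P Q R"
    using assms(1) by (auto simp: equisection_step_def anticlockwise_iff)
  define P' where "P' = of_real q * Q + of_real (1 - q) * R"
  define Q' where "Q' = of_real q * R + of_real (1 - q) * P"
  define R' where "R' = of_real q * P + of_real (1 - q) * Q"
  note r = resolvent_equisection[where q = q and P = P and Q = Q and R = R, folded P'_def Q'_def R'_def]
  have "tri_alpha A B C = tri_alpha P Q R"
    by (rule tri_alpha_relabel) (use o S assms in auto)
  also have "\<dots> = tri_alpha P' Q' R'"
    using r o by (simp add: tri_alpha_pos norm_mult)
  also have "\<dots> = tri_alpha X Y Z"
    by (rule tri_alpha_relabel[symmetric])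
      (use r(3)[OF o] S' assms(3) in \<open>auto simp: equisection_def P'_def Q'_def R'_def\<close>)
  finally show ?thesis .
qed

lemma tri_alpha_equisectionally_equivalent:
  assumes "equisectionally_equivalent S S'" "S = {A, B, C}" "orient A B C \<noteq> 0" "S' = {X, Y, Z}"
  shows "tri_alpha A B C = tri_alpha X Y Z"
proof -
  define r where "r = (\<lambda>S S'. is_triangle S \<and> is_triangle S' \<and>
                      (similar_triangles S S' \<or> equisection_step S S'))"
  have invariant: "tri_alpha A B C = tri_alpha X Y Z" if "r {A, B, C} {X, Y, Z}" for A B C X Y Z
  proof -
    have "is_triangle {A, B, C}" using that by (simp add: r_def)
    then obtain P Q R where "{A, B, C} = {P, Q, R}" "orient P Q R > 0"
      by (rule is_triangleE)
    then have "orient A B C \<noteq> 0" using orient_relabel[of P Q R A B C] by simp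
    then show ?thesis
      using that tri_alpha_similar(1)[of A B C X Y Z] tri_alpha_equisection_step[OF _ refl refl, of A B C X Y Z]
      unfolding r_def by auto
  qed
  have "equivclp r S S'" using assms(1) by (simp add: equisectionally_equivalent_def r_def)
  \<comment> \<open>The closure relates vertex sets, so the induction must cover every listing of
    the set reached.\<close>
  then have "\<forall>X Y Z. S' = {X, Y, Z} \<longrightarrow> tri_alpha A B C = tri_alpha X Y Z"
  proof (induction rule: equivclp_induct)
    case base
    then show ?case unfolding assms(2) using tri_alpha_relabel[OF assms(3)] by metis
  next
    case (step S1 S2)
    then have "is_triangle S1" by (auto simp: r_def)
    then obtain P Q R where S1: "S1 = {P, Q, R}" by (auto simp: is_triangle_def)
    have alpha1: "tri_alpha A B C = tri_alpha P Q R" using step.IH S1 by blast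
    \<comment> \<open>A link of the closure may be traversed in either direction.\<close>
    have alpha2: "tri_alpha P Q R = tri_alpha X Y Z" if "S2 = {X, Y, Z}" for X Y Z
      using step.hyps(2) invariant[of P Q R X Y Z] invariant[of X Y Z P Q R] unfolding S1 that by auto
    then show ?case unfolding alpha1 by blast
  qed
  then show ?thesis using assms(4) by blast
qed

subsection \<open>Classification of triangles by alpha\<close>

text \<open>The factor \<open>l\<close> matches both resolvents and the shift \<open>b\<close>
  matches the centroids; Fourier inversion then matches the vertices. Cross multiplication covers
  vanishing first resolvents.\<close>

lemma similar_if_resolvents_proportional:
  assumes "resolvent X Y Z * resolvent P R Q = resolvent P Q R * resolvent X Z Y"
    and "resolvent P R Q \<noteq> 0" "resolvent X Z Y \<noteq> 0"
  shows "similar_triangles {P, Q, R} {X, Y, Z}"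
proof -
  define l where "l = resolvent X Z Y / resolvent P R Q"
  define b where "b = ((X + Y + Z) - l * (P + Q + R)) / 3"
  have t: "resolvent X Z Y = l * resolvent P R Q" using assms(2) by (simp add: l_def)
  have s: "resolvent X Y Z = l * resolvent P Q R" using assms by (simp add: l_def field_simps)
  have b3: "3 * b = (X + Y + Z) - l * (P + Q + R)" by (simp add: b_def)
  \<comment> \<open>One computation for all three vertices, which differ only in the inversion
    coefficients \<open>c\<close> and \<open>d\<close>.\<close>
  have image: "l * U + b = U'"
    if "3 * U = (P + Q + R) + c * resolvent P Q R + d * resolvent P R Q"
      and "3 * U' = (X + Y + Z) + c * resolvent X Y Z + d * resolvent X Z Y" for U U' c d
  proof -
    have "3 * (l * U + b) = l * (3 * U) + 3 * b" by (simp add: algebra_simps)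
    also have "\<dots> = 3 * U'" unfolding that b3 s t by (simp add: algebra_simps)
    finally show ?thesis by (simp only: mult_cancel_left) simp
  qed
  have "l * P + b = X"
    by (rule image[of _ 1 1])
      (use resolvent_inversion[of P Q R] resolvent_inversion[of X Y Z] in simp_all)
  moreover have "l * Q + b = Y"
    by (rule image[of _ "cnj omega" omega])
      (simp_all add: resolvent_def cnj_omega algebra_simps omega_square omega_square_left)
  moreover have "l * R + b = Z"
    by (rule image[of _ omega "cnj omega"])
      (simp_all add: resolvent_def cnj_omega algebra_simps omega_square omega_square_left)
  ultimately have "(\<lambda>z. l * z + b) ` {P, Q, R} = {X, Y, Z}" by simp
  moreover have "l \<noteq> 0" using assms by (simp add: l_def)
  ultimately show ?thesis unfolding similar_triangles_def direct_similarity_def by blast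
qed

text \<open>The value -1 would require a purely imaginary factor, but all factors have real part
  -1/2.\<close>

lemma unit_eq_equisection_factor_quotient:
  assumes "cmod u = 1" "u \<noteq> - 1"
  obtains q where "u * cnj (equisection_factor q) = equisection_factor q"
proof -
  have n: "(Re u)\<^sup>2 + (Im u)\<^sup>2 = 1" using assms(1) by (metis cmod_power2 one_power2)
  have "1 + Re u \<noteq> 0"
  proof
    assume "1 + Re u = 0"
    then have "Re u = -1" by simp
    with n have "u = -1" by (simp add: complex_eq_iff)
    then show False using assms(2) by simp
  qed
  \<comment> \<open>The factor of q runs over the line of real part -1/2, so it must be the point of that line on the
    ray spanned by -(1 + u), whose square has the argument of u.\<close>
  define q where "q = (1 + Im u / (sqrt 3 * (1 + Re u))) / 2"
  have "Im (equisection_factor q) = - (sqrt 3 / 2) * (2 * q - 1)"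
    by (simp add: equisection_factor_def field_simps)
  also have "2 * q - 1 = Im u / (sqrt 3 * (1 + Re u))"
    by (simp add: q_def add_divide_distrib)
  also have "- (sqrt 3 / 2) * \<dots> = - Im u / (2 * (1 + Re u))"
    by simp
  finally have "equisection_factor q = Complex (- 1 / 2) (- Im u / (2 * (1 + Re u)))"
    by (simp add: equisection_factor_def complex_eq_iff algebra_simps)
  also have "\<dots> = - (1 + u) / of_real (2 * (1 + Re u))"
    using \<open>1 + Re u \<noteq> 0\<close>
    by (simp add: complex_eq_iff Re_divide_of_real Im_divide_of_real del: of_real_mult of_real_add)
      (simp add: field_simps)
  finally have e: "equisection_factor q = - (1 + u) / of_real (2 * (1 + Re u))" .
  \<comment> \<open>This gives \<open>u * cnj (1 + u) = 1 + u\<close>, so every real multiple of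
    \<open>1 + u\<close> solves the equation.\<close>
  have "u * cnj u = 1" using n by (simp add: complex_eq_iff power2_eq_square)
  then have "u * cnj (equisection_factor q) = equisection_factor q"
    unfolding e by (simp add: algebra_simps)
  then show thesis using that by blast
qed

text \<open>One operator, chosen to multiply the quotient of the resolvents by \<open>u\<close>,
  followed by one similarity.\<close>

lemma equisectionally_equivalent_if_unit_multiple:
  assumes o: "orient P Q R > 0" "orient X Y Z > 0"
    and u: "cmod u = 1" "u \<noteq> - 1"
    and eq: "resolvent X Y Z * resolvent P R Q = u * (resolvent P Q R * resolvent X Z Y)"
  shows "equisectionally_equivalent {P, Q, R} {X, Y, Z}"
proof -
  obtain q where q: "u * cnj (equisection_factor q) = equisection_factor q"
    using unit_eq_equisection_factor_quotient u by blast
  define P' where "P' = of_real q * Q + of_real (1 - q) * R"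
  define Q' where "Q' = of_real q * R + of_real (1 - q) * P"
  define R' where "R' = of_real q * P + of_real (1 - q) * Q"
  note r = resolvent_equisection[where q = q and P = P and Q = Q and R = R, folded P'_def Q'_def R'_def]
  have o': "orient P' Q' R' > 0" using r(3)[OF o(1)] .
  have "resolvent X Y Z * resolvent P' R' Q' = resolvent P' Q' R' * resolvent X Z Y"
  proof -
    have "resolvent X Y Z * (cnj (equisection_factor q) * resolvent P R Q) =
        cnj (equisection_factor q) * (resolvent X Y Z * resolvent P R Q)" by (simp add: mult_ac)
    also have "\<dots> = (u * cnj (equisection_factor q)) * (resolvent P Q R * resolvent X Z Y)"
      unfolding eq by (simp add: mult_ac)
    finally show ?thesis unfolding r q by (simp add: mult_ac)
  qed
  then have "similar_triangles {P', Q', R'} {X, Y, Z}"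
    using norm_resolvent_less[OF o'] norm_resolvent_less[OF o(2)]
    by (intro similar_if_resolvents_proportional) auto
  moreover have "equisection_step {P, Q, R} {P', Q', R'}"
    using o(1) unfolding equisection_step_def equisection_def anticlockwise_iff P'_def Q'_def R'_def
    by (intro exI[of _ q] exI[of _ P] exI[of _ Q] exI[of _ R]) simp
  moreover have "is_triangle {P, Q, R}" "is_triangle {P', Q', R'}" "is_triangle {X, Y, Z}"
    using o o' by (simp_all add: is_triangleI)
  ultimately show ?thesis
    unfolding equisectionally_equivalent_def
    using equivclp_trans[OF r_into_equivclp r_into_equivclp, of _ "{P, Q, R}" "{P', Q', R'}" "{X, Y, Z}"]
    by simp
qed

text \<open>Equal alphas make the cross products of the resolvents equal in modulus, so they differ
  by a unit. Regular triangles, where both products vanish, fall under the multiple -1.\<close>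

lemma equisectionally_equivalent_if_pos:
  assumes o: "orient P Q R > 0" "orient X Y Z > 0" and "tri_alpha P Q R = tri_alpha X Y Z"
  shows "equisectionally_equivalent {P, Q, R} {X, Y, Z}"
proof -
  let ?s = "resolvent P Q R" and ?t = "resolvent P R Q" and ?s' = "resolvent X Y Z" and ?t' = "resolvent X Z Y"
  have nz: "?t \<noteq> 0" "?t' \<noteq> 0" using norm_resolvent_less[OF o(1)] norm_resolvent_less[OF o(2)] by auto
  have "cmod ?s / cmod ?t = cmod ?s' / cmod ?t'"
    using assms by (simp add: tri_alpha_pos)
  then have n: "cmod (?s' * ?t) = cmod (?s * ?t')" using nz by (simp add: norm_mult field_simps)
  show ?thesis
  proof (cases "?s' * ?t = - (?s * ?t')")
    case False
    define u where "u = (if ?s = 0 then 1 else (?s' * ?t) / (?s * ?t'))"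
    show ?thesis
    proof (rule equisectionally_equivalent_if_unit_multiple[OF o])
      show "cmod u = 1" using n nz by (auto simp: u_def norm_divide)
      show "u \<noteq> -1" using False nz by (auto simp: u_def field_simps split: if_splits)
      show "?s' * ?t = u * (?s * ?t')" using n nz by (auto simp: u_def)
    qed
  next
    \<comment> \<open>The multiple -1 is not reached by any q; relabelling the target cyclically replaces it by
      another cube root of -1.\<close>
    case True
    have o3: "orient Y Z X > 0" using o(2) orient_rotate[of X Y Z] by simp
    have "equisectionally_equivalent {P, Q, R} {Y, Z, X}"
    proof (rule equisectionally_equivalent_if_unit_multiple[OF o(1) o3])
      show "cmod (- omega) = 1" by simp
      show "- omega \<noteq> -1" by (simp add: complex_eq_iff)
      \<comment> \<open>The rotation multiplies the first resolvent of the target by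
        \<open>cnj omega\<close> and the second by \<open>omega\<close>, hence their quotient by
        \<open>omega\<close>.\<close>
      have "cnj omega = omega * omega" by (simp add: cnj_omega omega_square)
      then show "resolvent Y Z X * ?t = - omega * (?s * resolvent Y X Z)"
        using True by (simp add: resolvent_rotate[of Y Z X] resolvent_rotate[of Z X Y] resolvent_rotate[of Y X Z] algebra_simps)
    qed
    then show ?thesis by (simp add: insert_commute)
  qed
qed

lemma equisectionally_equivalent_iff:
  assumes "orient A B C \<noteq> 0" "orient X Y Z \<noteq> 0"
  shows "equisectionally_equivalent {A, B, C} {X, Y, Z} \<longleftrightarrow> tri_alpha A B C = tri_alpha X Y Z"
proof
  assume "equisectionally_equivalent {A, B, C} {X, Y, Z}"
  then show "tri_alpha A B C = tri_alpha X Y Z"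
    using tri_alpha_equisectionally_equivalent assms by blast
next
  assume eq: "tri_alpha A B C = tri_alpha X Y Z"
  have "is_triangle {A, B, C}" "is_triangle {X, Y, Z}"
    using assms by (simp_all add: is_triangleI)
  obtain P Q R where S: "{A, B, C} = {P, Q, R}" and o: "orient P Q R > 0"
    using \<open>is_triangle {A, B, C}\<close> by (rule is_triangleE)
  obtain U V W where S': "{X, Y, Z} = {U, V, W}" and o': "orient U V W > 0"
    using \<open>is_triangle {X, Y, Z}\<close> by (rule is_triangleE)
  have "tri_alpha P Q R = tri_alpha U V W"
    using eq tri_alpha_relabel[OF assms(1) S[symmetric]] tri_alpha_relabel[OF assms(2) S'[symmetric]]
    by simp
  then show "equisectionally_equivalent {A, B, C} {X, Y, Z}"
    unfolding S S' by (rule equisectionally_equivalent_if_pos[OF o o'])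
qed

subsection \<open>Area and beta\<close>

text \<open>Coordinate map carrying triangles to \<open>real^2\<close>, where
  \<open>content_triangle\<close> applies.\<close>

lemma linear_complex_vector: "linear (\<lambda>z. vector [Re z, Im z] :: real^2)"
  by (intro linearI) (auto simp: vec_eq_iff forall_2)

lemma borel_measurable_complex_vector: "(\<lambda>z. vector [Re z, Im z] :: real^2) \<in> borel_measurable lborel"
  using linear_complex_vector
  by (simp add: borel_measurable_continuous_onI linear_continuous_on linear_conv_bounded_linear)

text \<open>Lebesgue measure is determined by its values on boxes, and the preimage of a box is a
  complex box with the same sides.\<close>

lemma lborel_eq_distr_complex:
  "lborel = distr (lborel :: complex measure) borel (\<lambda>z. vector [Re z, Im z] :: real^2)"
proof (rule lborel_eqI)
  let ?h = "\<lambda>z. vector [Re z, Im z] :: real^2"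
  fix l u :: "real^2"
  assume le: "\<And>b. b \<in> Basis \<Longrightarrow> l \<bullet> b \<le> u \<bullet> b"
  have lu: "l $ i \<le> u $ i" for i
    using le[of "axis i 1"] by (simp add: inner_axis)
  have "emeasure (distr lborel borel ?h) (box l u) = emeasure lborel (?h -` box l u)"
    using borel_measurable_complex_vector by (simp add: emeasure_distr)
  also have "?h -` box l u = box (Complex (l $ 1) (l $ 2)) (Complex (u $ 1) (u $ 2))"
    by (auto simp: mem_box_cart forall_2 in_box_complex_iff)
  also have "emeasure lborel \<dots> = (u $ 1 - l $ 1) * (u $ 2 - l $ 2)"
    using lu by (subst emeasure_lborel_box) (auto simp: Basis_complex_def)
  also have "\<dots> = (\<Prod>b\<in>Basis. (u - l) \<bullet> b)"
  proof -
    have Basis: "(Basis :: (real^2) set) = {axis 1 1, axis 2 1}"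
      by (auto simp: Basis_vec_def UNIV_2)
    have "(axis 1 1 :: real^2) \<noteq> axis 2 1" by (simp add: axis_eq_axis)
    then have "(\<Prod>b\<in>Basis. (u - l) \<bullet> b) = (u $ 1 - l $ 1) * (u $ 2 - l $ 2)"
      unfolding Basis by (simp add: inner_axis)
    then show ?thesis by simp
  qed
  finally show "emeasure (distr lborel borel ?h) (box l u) = (\<Prod>b\<in>Basis. (u - l) \<bullet> b)" .
qed simp

lemma measure_triangle: "measure lebesgue (convex hull {A, B, C}) = \<bar>orient A B C\<bar> / 2"
proof -
  let ?h = "\<lambda>z. vector [Re z, Im z] :: real^2" and ?T = "convex hull {A, B, C}"
  have "inj ?h" by (auto simp: inj_on_def vec_eq_iff forall_2 complex_eq_iff)
  \<comment> \<open>Compact sets are Borel, which permits the passage from \<open>lebesgue\<close>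
    to \<open>lborel\<close> and along the coordinate map.\<close>
  have "compact ?T" "compact (?h ` ?T)"
    using linear_complex_vector by (auto intro!: compact_continuous_image linear_continuous_on
        finite_imp_compact_convex_hull simp: linear_conv_bounded_linear)
  then have borel: "?T \<in> sets borel" "?h ` ?T \<in> sets borel"
    by (auto simp: borel_compact)
  have "measure lebesgue ?T = measure lborel ?T"
    using borel by (simp add: measure_completion)
  also have "\<dots> = measure lborel (?h -` ?h ` ?T)"
    using \<open>inj ?h\<close> by (simp add: inj_vimage_image_eq)
  also have "\<dots> = measure (distr lborel borel ?h) (?h ` ?T)"
    using borel borel_measurable_complex_vector by (simp add: measure_distr)
  also have "\<dots> = measure lborel (?h ` ?T)"
    by (simp flip: lborel_eq_distr_complex)
  also have "?h ` ?T = convex hull {?h A, ?h B, ?h C}"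
    by (simp add: convex_hull_linear_image[OF linear_complex_vector])
  also have "measure lborel \<dots> = \<bar>orient A B C\<bar> / 2"
    by (simp add: content_triangle orient_def algebra_simps)
  finally show ?thesis .
qed

text \<open>\<open>norm_resolvent_diff\<close> divided by the squared modulus of the second
  resolvent; the area is half of \<open>orient\<close>, whence the constant
  \<open>4 * sqrt 3\<close>.\<close>

lemma tri_beta_eq:
  assumes "orient A B C \<noteq> 0"
  shows "tri_beta A B C = (1 - (tri_alpha A B C)\<^sup>2) / (4 * sqrt 3)"
proof -
  have *: "tri_beta A B C = (1 - (tri_alpha A B C)\<^sup>2) / (4 * sqrt 3)" if o: "orient A B C > 0" for B C
  proof -
    let ?s = "cmod (resolvent A B C)" and ?t = "cmod (resolvent A C B)"
    have "?t > 0" using norm_resolvent_less[OF o] norm_ge_zero le_less_trans by blast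
    have "1 - (?s / ?t)\<^sup>2 = (?t\<^sup>2 - ?s\<^sup>2) / ?t\<^sup>2" using \<open>?t > 0\<close> by (simp add: field_simps)
    also have "\<dots> = 2 * sqrt 3 * orient A B C / ?t\<^sup>2" by (simp add: norm_resolvent_diff)
    finally show ?thesis
      using o by (simp add: tri_beta_def measure_triangle dist_apex_far tri_alpha_pos)
  qed
  show ?thesis
  proof (cases "orient A B C > 0")
    case False
    then have "orient A C B > 0" using assms by (simp add: orient_swap[of A B C])
    then show ?thesis using *[of C B] by (simp add: tri_alpha_swap tri_beta_swap)
  qed (rule *)
qed

text \<open>Squaring is injective on the nonnegative values of alpha.\<close>

lemma tri_alpha_eq_iff_tri_beta_eq:
  assumes "orient A B C \<noteq> 0" "orient X Y Z \<noteq> 0"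
  shows "tri_alpha A B C = tri_alpha X Y Z \<longleftrightarrow> tri_beta A B C = tri_beta X Y Z"
  using tri_alpha_bounds(1)[OF assms(1)] tri_alpha_bounds(1)[OF assms(2)]
  by (simp add: tri_beta_eq assms)

subsection \<open>Circles\<close>

text \<open>Centre and radius come from completing the square in the squared distance
  equation.\<close>

lemma apollonius_circle_eq_sphere:
  assumes "0 < k" "k < 1" "D \<noteq> E"
  shows "\<exists>c r. r > 0 \<and> apollonius_circle D E k = sphere c r"
proof (intro exI conjI set_eqI)
  define m where "m = 1 - k\<^sup>2"
  have m: "m > 0" using assms by (simp add: m_def power_less_one_iff)
  define c where "c = (D - k\<^sup>2 *\<^sub>R E) /\<^sub>R m"
  define r where "r = k * dist D E / m"
  show "r > 0" using assms m by (simp add: r_def)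
  fix X
  \<comment> \<open>The factor \<open>m\<^sup>2\<close> clears denominators, leaving a polynomial
    identity in coordinates.\<close>
  have key: "m\<^sup>2 * ((dist X c)\<^sup>2 - r\<^sup>2) = m * ((dist X D)\<^sup>2 - (k * dist X E)\<^sup>2)"
  proof -
    have "m\<^sup>2 * (dist X c)\<^sup>2 = (cmod (m *\<^sub>R (X - c)))\<^sup>2"
      using m by (simp add: dist_norm power_mult_distrib)
    also have "m *\<^sub>R (X - c) = m *\<^sub>R X - (D - k\<^sup>2 *\<^sub>R E)"
      using m by (simp add: c_def scaleR_diff_right)
    finally have 1: "m\<^sup>2 * (dist X c)\<^sup>2 = (cmod (m *\<^sub>R X - (D - k\<^sup>2 *\<^sub>R E)))\<^sup>2" .
    have 2: "m\<^sup>2 * r\<^sup>2 = (k * dist D E)\<^sup>2" using m by (simp add: r_def power_divide)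
    have "m\<^sup>2 * ((dist X c)\<^sup>2 - r\<^sup>2) = (cmod (m *\<^sub>R X - (D - k\<^sup>2 *\<^sub>R E)))\<^sup>2 - (k * dist D E)\<^sup>2"
      unfolding 1[symmetric] 2[symmetric] by (rule right_diff_distrib)
    also have "\<dots> = m * ((dist X D)\<^sup>2 - (k * dist X E)\<^sup>2)"
      unfolding power_mult_distrib dist_norm cmod_power2 m_def
      by (simp add: power2_eq_square algebra_simps)
    finally show ?thesis .
  qed
  \<comment> \<open>The product form also excludes \<open>X = E\<close>, where it would say
    \<open>dist E D = 0\<close>.\<close>
  have "X \<in> apollonius_circle D E k \<longleftrightarrow> dist X D = k * dist X E"
    using assms by (auto simp: apollonius_circle_def divide_simps)
  also have "\<dots> \<longleftrightarrow> (dist X D)\<^sup>2 = (k * dist X E)\<^sup>2" using assms(1) by simp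
  also have "\<dots> \<longleftrightarrow> (dist X c)\<^sup>2 = r\<^sup>2" using key m by auto
  also have "\<dots> \<longleftrightarrow> dist X c = r" using \<open>r > 0\<close> by simp
  finally show "X \<in> apollonius_circle D E k \<longleftrightarrow> X \<in> sphere c r" by (simp add: dist_commute)
qed

text \<open>Two circles with distinct centres c and c' meet on a line perpendicular to c' - c, in the
  coordinate z = (x - c) / (c' - c) a line of constant real part, and such a line contains at most
  two points with given modulus of z.\<close>

lemma sphere_eq_if_three_points:
  fixes c c' :: complex
  assumes "{P, Q, R} \<subseteq> sphere c r \<inter> sphere c' r'" "P \<noteq> Q" "Q \<noteq> R" "P \<noteq> R"
  shows "sphere c r = sphere c' r'"
proof (cases "c = c'")
  case True
  then show ?thesis using assms(1) by auto
next
  case False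
  define d where "d = c' - c"
  have "d \<noteq> 0" using False by (simp add: d_def)
  define s s' where "s = (r / cmod d)\<^sup>2" and "s' = (r' / cmod d)\<^sup>2"
  \<comment> \<open>Subtracting the equations for the moduli of \<open>z\<close> and
    \<open>z - 1\<close> gives \<open>2 * Re z - 1 = s - s'\<close>.\<close>
  define p where "p = (1 + s - s') / 2"
  define y where "y = sqrt (s - p\<^sup>2)"
  define w where "w = (\<lambda>X. (X - c) / d)"
  have two: "w X \<in> {Complex p y, Complex p (- y)}" if "X \<in> {P, Q, R}" for X
  proof -
    define z where "z = (X - c) / d"
    have X: "X - c = z * d" "X - c' = (z - 1) * d"
      using \<open>d \<noteq> 0\<close> by (simp_all add: z_def d_def field_simps)
    have "cmod (X - c) = r" "cmod (X - c') = r'"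
      using assms(1) that by (auto simp: dist_norm norm_minus_commute)
    then have "cmod z = r / cmod d" "cmod (z - 1) = r' / cmod d"
      using \<open>d \<noteq> 0\<close> by (simp_all add: X norm_mult eq_divide_eq)
    then have n: "(Re z)\<^sup>2 + (Im z)\<^sup>2 = s" "(Re z - 1)\<^sup>2 + (Im z)\<^sup>2 = s'"
      unfolding s_def s'_def using cmod_power2[of z] cmod_power2[of "z - 1"] by simp_all
    then have "Re z = p" by (simp add: p_def power2_diff field_simps)
    moreover from this n have "\<bar>Im z\<bar> = y" unfolding y_def by (intro real_sqrt_unique[symmetric]) auto
    ultimately show ?thesis unfolding w_def z_def[symmetric] by (auto simp: complex_eq_iff)
  qed
  have "w P \<noteq> w Q" "w Q \<noteq> w R" "w P \<noteq> w R"
    using assms(2-4) \<open>d \<noteq> 0\<close> by (auto simp: w_def)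
  then have False using two[of P] two[of Q] two[of R] by auto
  then show ?thesis ..
qed

lemma circle_through_eq:
  assumes "\<exists>c r. r > 0 \<and> S = sphere c r" "{P, Q, R} \<subseteq> S" "P \<noteq> Q" "Q \<noteq> R" "P \<noteq> R"
  shows "circle_through P Q R = S"
  unfolding circle_through_def
proof (rule the_equality)
  fix S' assume S': "(\<exists>c r. r > 0 \<and> S' = sphere c r) \<and> P \<in> S' \<and> Q \<in> S' \<and> R \<in> S'"
  obtain c r c' r' where "S = sphere c r" "S' = sphere c' r'" using assms(1) S' by blast
  then show "S' = S"
    using sphere_eq_if_three_points[of P Q R c r c' r'] assms S' by auto
qed (use assms in auto)

section \<open>Similarity with matched vertices and the three points on the circle\<close>

lemma similar_in_order_refl: "similar_in_order A B C A B C"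
  unfolding similar_in_order_def direct_similarity_def
  by (intro exI[of _ "\<lambda>z. z"] conjI exI[of _ 1] exI[of _ 0]) auto

text \<open>The second similarity is composed with the inverse of the first; together with
  reflexivity this form also yields symmetry.\<close>

lemma similar_in_order_trans:
  assumes "similar_in_order A B C A' B' C'" "similar_in_order A B C A'' B'' C''"
  shows "similar_in_order A' B' C' A'' B'' C''"
proof -
  obtain a b where f: "a \<noteq> 0" "A' = a * A + b" "B' = a * B + b" "C' = a * C + b"
    using assms(1) by (auto simp: similar_in_order_def direct_similarity_def)
  obtain a' b' where g: "a' \<noteq> 0" "A'' = a' * A + b'" "B'' = a' * B + b'" "C'' = a' * C + b'"
    using assms(2) by (auto simp: similar_in_order_def direct_similarity_def)
  have "direct_similarity (\<lambda>z. (a' / a) * z + (b' - a' * b / a))"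
    unfolding direct_similarity_def using f(1) g(1) by (intro exI[of _ "a' / a"] exI[of _ "b' - a' * b / a"]) auto
  moreover have "(a' / a) * (a * X + b) + (b' - a' * b / a) = a' * X + b'" for X
    using f(1) by (simp add: field_simps)
  ultimately show ?thesis unfolding similar_in_order_def f g by metis
qed

lemma similar_in_order_imp_similar:
  "similar_in_order A B C A' B' C' \<Longrightarrow> similar_triangles {A, B, C} {A', B', C'}"
  by (auto simp: similar_in_order_def similar_triangles_def)

text \<open>The similarity multiplies each side vector by \<open>a\<close> to give the next. Going
  round once gives \<open>cmod a ^ 3 = 1\<close>, so all sides are equal.\<close>

lemma regular_if_similar_to_rotation:
  assumes "orient P Q R \<noteq> 0" "similar_in_order P Q R Q R P"
  shows "regular_triangle P Q R"
proof -
  obtain a b where f: "Q = a * P + b" "R = a * Q + b" "P = a * R + b"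
    using assms(2) unfolding similar_in_order_def direct_similarity_def by metis
  have e: "Q - R = a * (P - Q)" "R - P = a * (Q - R)" "P - Q = a * (R - P)"
    using f by (auto simp: algebra_simps)
  have d: "dist Q R = cmod a * dist P Q" "dist R P = cmod a * dist Q R"
     "dist P Q = cmod a * dist R P"
    unfolding dist_norm norm_mult[symmetric] by (fact arg_cong[OF e(1)] arg_cong[OF e(2)] arg_cong[OF e(3)])+
  have "dist P Q > 0" using orient_distinct[OF assms(1)] by simp
  have "dist P Q = cmod a ^ 3 * dist P Q"
    using d by (simp add: power3_eq_cube mult.assoc)
  then have "cmod a ^ 3 = 1" using \<open>dist P Q > 0\<close> by simp
  then have "cmod a = 1" using power_eq_1_iff[of "cmod a" 3] by simp
  then show ?thesis
    using d assms(1) by (simp add: regular_triangle_def collinear_iff_orient)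
qed

text \<open>Points on one side of the base share the half plane and thus both apexes, so alpha
  becomes a ratio of distances to fixed foci.\<close>

lemma tri_alpha_in_half_plane:
  assumes "orient A B C \<noteq> 0" "X \<in> open_half_plane A B C"
    and "D \<in> open_half_plane A B C" "regular_triangle D B C"
    and "Dbar \<notin> open_half_plane A B C" "regular_triangle Dbar B C"
  shows "orient X B C \<noteq> 0" "tri_alpha X B C = dist X D / dist X Dbar"
proof -
  have pos: "orient A B C * orient X B C > 0"
    using assms(1,2) by (simp add: open_half_plane_iff)
  then show o: "orient X B C \<noteq> 0" by auto
  have "open_half_plane X B C = open_half_plane A B C"
    using pos assms(1) o by (auto simp: open_half_plane_iff zero_less_mult_iff)
  then show "tri_alpha X B C = dist X D / dist X Dbar"
    unfolding tri_alpha_def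
    using apex_near_unique[OF o, of D] apex_far_unique[OF o, of Dbar] assms by simp
qed

theorem theorem2:
  fixes A B C A' B' C' D Dbar Ahat A2 A3 :: complex
  assumes "\<not> collinear {A, B, C}"
    and "\<not> collinear {A', B', C'}"
    and "D \<in> open_half_plane A B C" and "regular_triangle D B C"
    and "Dbar \<notin> open_half_plane A B C" and "regular_triangle Dbar B C"
    and "Ahat \<in> open_half_plane A B C" and "similar_triangles {Ahat, B, C} {A', B', C'}"
    and "A2 \<in> open_half_plane A B C" and "similar_in_order A B C B C A2"
    and "A3 \<in> open_half_plane A B C" and "similar_in_order A B C C A3 B"
  defines "C\<^sub>A \<equiv> apollonius_circle D Dbar (tri_alpha A B C)"
  shows "(equisectionally_equivalent {A, B, C} {A', B', C'}
            \<longleftrightarrow> tri_alpha A B C = tri_alpha A' B' C') \<and>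
         (tri_alpha A B C = tri_alpha A' B' C' \<longleftrightarrow> Ahat \<in> C\<^sub>A) \<and>
         (tri_alpha A B C = tri_alpha A' B' C' \<longleftrightarrow> tri_beta A B C = tri_beta A' B' C') \<and>
         (tri_alpha A B C = tri_alpha A' B' C'
            \<longleftrightarrow> Ahat \<in> (if regular_triangle A B C then {A} else circle_through A A2 A3)) \<and>
         A \<in> C\<^sub>A \<and> (regular_triangle A B C \<longrightarrow> C\<^sub>A = {A})"
proof -
  have o: "orient A B C \<noteq> 0" and o': "orient A' B' C' \<noteq> 0"
    using assms(1,2) by (simp_all add: collinear_iff_orient)
  note half = tri_alpha_in_half_plane[OF o _ assms(3-6)]
  have "A \<in> open_half_plane A B C" using o by (simp add: open_half_plane_iff flip: power2_eq_square)
  \<comment> \<open>\<open>Dbar\<close> lies outside the half plane, so the exclusion of this focus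
    costs nothing for \<open>X\<close>.\<close>
  have mem: "X \<in> C\<^sub>A \<longleftrightarrow> tri_alpha X B C = tri_alpha A B C" if "X \<in> open_half_plane A B C" for X
    using half(2)[OF that] that assms(5) by (auto simp: C\<^sub>A_def apollonius_circle_def)
  have "D \<noteq> Dbar" using assms(3,5) by auto
  have A: "A \<in> C\<^sub>A" using mem[OF \<open>A \<in> open_half_plane A B C\<close>] by simp
  have "tri_alpha A' B' C' = tri_alpha Ahat B C"
    using tri_alpha_similar(1)[OF half(1)[OF assms(7)] assms(8)] .
  then have Ahat: "tri_alpha A B C = tri_alpha A' B' C' \<longleftrightarrow> Ahat \<in> C\<^sub>A"
    using mem[OF assms(7)] by auto
  have regular: "C\<^sub>A = {A}" if "regular_triangle A B C"
  proof -
    \<comment> \<open>The vertex is its own near apex, so alpha is 0 and the locus shrinks to the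
      focus \<open>D\<close>.\<close>
    have "A = D"
      using apex_near_unique[OF o \<open>A \<in> open_half_plane A B C\<close> that] apex_near_unique[OF o assms(3,4)]
      by simp
    then have "tri_alpha A B C = 0" using half(2)[OF \<open>A \<in> open_half_plane A B C\<close>] by simp
    then show ?thesis
      using \<open>A = D\<close> \<open>D \<noteq> Dbar\<close> by (auto simp: C\<^sub>A_def apollonius_circle_def)
  qed
  have circle: "circle_through A A2 A3 = C\<^sub>A" if "\<not> regular_triangle A B C"
  proof (rule circle_through_eq)
    have "A \<noteq> D" using that assms(4) by auto
    then have "tri_alpha A B C \<noteq> 0"
      using half(2)[OF \<open>A \<in> open_half_plane A B C\<close>] \<open>A \<in> open_half_plane A B C\<close> assms(5) by auto
    then have "tri_alpha A B C > 0" "tri_alpha A B C < 1"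
      using tri_alpha_bounds[OF o] by auto
    then show "\<exists>c r. r > 0 \<and> C\<^sub>A = sphere c r"
      unfolding C\<^sub>A_def using \<open>D \<noteq> Dbar\<close> by (intro apollonius_circle_eq_sphere)
    have "{B, C, A2} = {A2, B, C}" "{C, A3, B} = {A3, B, C}" by auto
    then have "similar_triangles {A, B, C} {A2, B, C}" "similar_triangles {A, B, C} {A3, B, C}"
      using assms(10,12)[THEN similar_in_order_imp_similar] by simp_all
    from this[THEN tri_alpha_similar(1)[OF o]] have "A2 \<in> C\<^sub>A" "A3 \<in> C\<^sub>A"
      using mem[OF assms(9)] mem[OF assms(11)] by simp_all
    then show "{A, A2, A3} \<subseteq> C\<^sub>A" using A by simp
    show "A \<noteq> A2" using regular_if_similar_to_rotation[OF o] assms(10) that by auto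
    show "A \<noteq> A3"
    proof
      assume "A = A3"
      \<comment> \<open>Inverts the given similarity, exhibiting it as a rotation of the labels
        \<open>C A B\<close>.\<close>
      then have "similar_in_order C A B A B C"
        using similar_in_order_trans[OF assms(12) similar_in_order_refl] by simp
      moreover have "orient C A B \<noteq> 0" using o orient_rotate[of C A B] by simp
      ultimately have "regular_triangle C A B" using regular_if_similar_to_rotation by blast
      then show False using that regular_triangle_rotate[of C A B] by simp
    qed
    show "A2 \<noteq> A3"
    proof
      assume "A2 = A3"
      \<comment> \<open>Here the triangle \<open>B C A2\<close> is regular, so \<open>A2\<close> is
        the focus \<open>D\<close> with ratio 0, although it has the same nonzero alpha as
        \<open>A\<close>.\<close>
      then have rot: "similar_in_order B C A2 C A2 B"
        using similar_in_order_trans[OF assms(10,12)] by simp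
      have "orient B C A2 \<noteq> 0" using half(1)[OF assms(9)] orient_rotate[of A2 B C] by simp
      then have "regular_triangle B C A2" using rot by (rule regular_if_similar_to_rotation)
      then have "A2 = D"
        using apex_near_unique[OF o assms(9)] apex_near_unique[OF o assms(3,4)]
          regular_triangle_rotate[of A2 B C] by simp
      then have "tri_alpha A B C = 0"
        using half(2)[OF assms(9)] mem[OF assms(9)] \<open>A2 \<in> C\<^sub>A\<close> by simp
      then show False using \<open>tri_alpha A B C \<noteq> 0\<close> by blast
    qed
  qed
  show ?thesis
    using equisectionally_equivalent_iff[OF o o'] tri_alpha_eq_iff_tri_beta_eq[OF o o'] Ahat A
      regular circle by auto
qed

end
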